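(* Let $(X_i)_{i\ge 1}$ be i.i.d. standard Gaussian random variables on a probability space with probability measure $\mathbb{P}$, and for $n\ge 2$ let $X_{(n)}=\max_{1\le i\le n}X_i$ and $$a_n=\sqrt{2\log n},\qquad b_n=a_n-\frac{\log(\sqrt{2\pi}\,a_n)}{a_n},\qquad Z_n=\frac{a_n(X_{(n)}-b_n)}{\log n}=\frac{X_{(n)}-b_n}{a_n/2}.$$ Then, for every Borel set $A\subset[0,\infty)$, $$\lim_{n\to\infty}\frac{1}{\log n}\log\mathbb{P}(Z_n\in A)=-\operatorname*{ess\,inf}_{x\in A}\left(x+\frac{x^2}{4}\right).$$
   Context: Here $\log$ is the natural logarithm. The essential infimum over $A$ is taken with respect to Lebesgue measure: $\operatorname{ess\,inf}_{x\in A} g(x)$ is the supremum of all $c\in\mathbb{R}$ such that $\{x\in A: g(x)<c\}$ has Lebesgue measure zero. The conventions are $\log 0=-\infty$ and that the essential infimum over a Lebesgue-null set is $+\infty$; the limit is taken in $[-\infty,\infty)$. *)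

theory Defs
  imports "HOL-Probability.Probability"
begin

text \<open>
  The library's \<^const>\<open>ln\<close> is real-valued with \<open>ln 0 = 0\<close>; here \<open>log 0\<close> is \<open>-\<infinity>\<close>.
  Only applied to nonnegative arguments.
\<close>
definition eln :: "real \<Rightarrow> ereal"
  where "eln p = (if p = 0 then -\<infinity> else ereal (ln p))"

text \<open>
  The supremum is taken in the extended reals: it is \<open>\<infinity>\<close> for a null set \<open>A\<close>, and \<open>-\<infinity>\<close> if no
  real \<open>c\<close> qualifies.
\<close>
definition ess_inf_on :: "real set \<Rightarrow> (real \<Rightarrow> real) \<Rightarrow> ereal"
  where "ess_inf_on A g = Sup {ereal c | c. {x \<in> A. g x < c} \<in> null_sets lebesgue}"

lemma ess_inf_on_null:
  assumes "A \<in> null_sets lebesgue"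
  shows "ess_inf_on A g = \<infinity>"
proof -
  have "{x \<in> A. g x < c} \<in> null_sets lebesgue" for c
    by (rule null_sets_completion_subset[OF _ assms]) auto
  then have "ereal c \<le> ess_inf_on A g" for c
    unfolding ess_inf_on_def by (intro Sup_upper) auto
  then show ?thesis
    by (intro ereal_top) auto
qed

definition a_seq :: "nat \<Rightarrow> real"
  where "a_seq n = sqrt (2 * ln (real n))"

definition b_seq :: "nat \<Rightarrow> real"
  where "b_seq n = a_seq n - ln (sqrt (2 * pi) * a_seq n) / a_seq n"

text \<open>
  The sample is \<open>X 1, X 2, \<dots>\<close>; \<open>X 0\<close> is never used. Both definitions below are meant for \<open>n \<ge> 2\<close>.
\<close>
definition sample_max :: "(nat \<Rightarrow> 'a \<Rightarrow> real) \<Rightarrow> nat \<Rightarrow> 'a \<Rightarrow> real"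
  where "sample_max X n \<omega> = (MAX i\<in>{1..n}. X i \<omega>)"

definition Z_seq :: "(nat \<Rightarrow> 'a \<Rightarrow> real) \<Rightarrow> nat \<Rightarrow> 'a \<Rightarrow> real"
  where "Z_seq X n \<omega> = a_seq n * (sample_max X n \<omega> - b_seq n) / ln (real n)"

lemma Z_seq_alt:
  assumes "n \<ge> 2"
  shows "Z_seq X n \<omega> = (sample_max X n \<omega> - b_seq n) / (a_seq n / 2)"
proof -
  have "ln (real n) > 0"
    using assms by simp
  then have ln_n: "ln (real n) = a_seq n * a_seq n / 2" and "a_seq n > 0"
    by (simp_all add: a_seq_def)
  show ?thesis
    unfolding Z_seq_def ln_n using \<open>a_seq n > 0\<close> by (simp add: divide_simps)
qed

end

theory Submission
  imports Defs "HOL-Real_Asymp.Real_Asymp"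
begin

text \<open>
  The probability that the maximum of an i.i.d. sample lies in a set \<open>B\<close> to the right of \<open>b\<^sub>n\<close> is,
  up to a factor that the logarithmic scale does not see, \<open>n\<close> times the probability that one
  observation lies in \<open>B\<close>. The union bound (\<open>prob_Max_le\<close>) is one half of this. For the other half
  (\<open>prob_Max_ge\<close>), the events ``observation \<open>i\<close> lies in \<open>B\<close> and all the others are below \<open>b\<^sub>n\<close>'' are
  disjoint; compared with the union bound they lose the factor \<open>\<Phi>(b\<^sub>n) ^ (n - 1)\<close>, where \<open>\<Phi>\<close> is the
  normal distribution function. Already the crude bound \<open>1 - \<Phi>(b\<^sub>n) \<le> sqrt (2 * pi) * \<phi>(b\<^sub>n)\<close>, with
  \<open>\<phi>\<close> the normal density, makes \<open>n * (1 - \<Phi>(b\<^sub>n))\<close> of order at most \<open>a\<^sub>n = o(log n)\<close>, so this factor is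
  \<open>exp (- o(log n))\<close> (\<open>no_exceedance_rate\<close>).

  It remains to estimate a Gaussian integral. Let \<open>s = a\<^sub>n / 2\<close>. The substitution \<open>y = b\<^sub>n + s * x\<close> gives
  \<open>n * P(X\<^sub>1 \<in> b\<^sub>n + s * A)\<close> as the integral over \<open>A\<close> of
  \<open>w\<^sub>n * exp (- (b\<^sub>n * s * x + s\<^sup>2 * x\<^sup>2 / 2))\<close>, where \<open>w\<^sub>n = n * s * \<phi>(b\<^sub>n)\<close>. The
  centring \<open>b\<^sub>n\<close> is chosen so that \<open>n * \<phi>(b\<^sub>n)\<close> is close to \<open>a\<^sub>n\<close>; hence \<open>log w\<^sub>n = o(log n)\<close>
  (\<open>prefactor_rate\<close>). Since \<open>2 * s\<^sup>2 = log n\<close> and \<open>b\<^sub>n * s\<close> is asymptotic to \<open>log n\<close>, the exponent is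
  essentially \<open>- log n * (x + x\<^sup>2 / 4)\<close>. This is Laplace's method: with \<open>m\<close> the essential infimum of
  \<open>x + x\<^sup>2 / 4\<close> over \<open>A\<close>, the integral is at most about \<open>exp (- m * log n)\<close>
  (\<open>std_normal_affine_le\<close>), and for \<open>c > m\<close> it is at least \<open>exp (- c * log n)\<close> times the positive
  measure of the part of \<open>A\<close> where \<open>x + x\<^sup>2 / 4 < c\<close> (\<open>std_normal_affine_ge\<close>).
  If \<open>A\<close> is null, the integral vanishes, and both sides of the claim are \<open>-\<infinity>\<close>.
\<close>

section \<open>Essential infimum\<close>

text \<open>
  The essential infimum is attained as an essential lower bound: the strict sublevel set at \<open>m\<close> is
  the countable union of those at the levels \<open>m - 1 / Suc k\<close>.
\<close>
lemma null_sublevel_ess_inf_on: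
  assumes "ess_inf_on A g = ereal m"
  shows "{x \<in> A. g x < m} \<in> null_sets lebesgue"
proof -
  have null: "{x \<in> A. g x < m - 1 / real (Suc k)} \<in> null_sets lebesgue" for k
  proof -
    have "ereal (m - 1 / real (Suc k)) < ess_inf_on A g"
      using assms by simp
    then obtain c where c: "m - 1 / real (Suc k) < c" "{x \<in> A. g x < c} \<in> null_sets lebesgue"
      unfolding ess_inf_on_def by (auto simp: less_Sup_iff)
    show ?thesis
      by (rule null_sets_completion_subset[OF _ c(2)]) (use c(1) in auto)
  qed
  have "{x \<in> A. g x < m} = (\<Union>k. {x \<in> A. g x < m - 1 / real (Suc k)})"
  proof safe
    fix x assume "x \<in> A" "g x < m"
    then obtain k where "1 / real (Suc k) < m - g x"
      using nat_approx_posE[of "m - g x"] by auto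
    then show "x \<in> (\<Union>k. {x \<in> A. g x < m - 1 / real (Suc k)})"
      using \<open>x \<in> A\<close> by (intro UN_I[of k]) auto
  next
    fix x k assume "g x < m - 1 / real (Suc k)"
    moreover have "1 / real (Suc k) > 0" by simp
    ultimately show "g x < m" by linarith
  qed
  then show ?thesis
    using null by (simp add: null_sets_UN)
qed

lemma not_null_sublevel_above_ess_inf_on:
  assumes "ess_inf_on A g = ereal m" "m < c"
  shows "{x \<in> A. g x < c} \<notin> null_sets lebesgue"
proof
  assume "{x \<in> A. g x < c} \<in> null_sets lebesgue"
  then have "ereal c \<le> ess_inf_on A g"
    unfolding ess_inf_on_def by (intro Sup_upper) auto
  with assms show False by simp
qed

text \<open>
  An infinite essential infimum would make every sublevel set null, and countably many of them
  cover \<open>A\<close>.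
\<close>
lemma ess_inf_on_finite:
  assumes "A \<notin> null_sets lebesgue" "\<And>x. x \<in> A \<Longrightarrow> 0 \<le> g x"
  obtains m where "ess_inf_on A g = ereal m"
proof -
  have "{x \<in> A. g x < 0} = {}"
    using assms(2) by force
  then have "{x \<in> A. g x < 0} \<in> null_sets lebesgue"
    by (simp only: null_sets.empty_sets)
  then have "ereal 0 \<le> ess_inf_on A g"
    unfolding ess_inf_on_def by (intro Sup_upper) blast
  moreover have "ess_inf_on A g \<noteq> \<infinity>"
  proof
    assume inf: "ess_inf_on A g = \<infinity>"
    have "{x \<in> A. g x < real k} \<in> null_sets lebesgue" for k
    proof -
      have "ereal (real k) < ess_inf_on A g"
        using inf by simp
      then obtain c where c: "real k < c" "{x \<in> A. g x < c} \<in> null_sets lebesgue"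
        unfolding ess_inf_on_def by (auto simp: less_Sup_iff)
      show ?thesis
        by (rule null_sets_completion_subset[OF _ c(2)]) (use c(1) in auto)
    qed
    then have "(\<Union>k. {x \<in> A. g x < real k}) \<in> null_sets lebesgue"
      by (rule null_sets_UN)
    also have "(\<Union>k. {x \<in> A. g x < real k}) = A"
      using reals_Archimedean2 by auto
    finally show False using assms(1) by simp
  qed
  ultimately show ?thesis
    using that by (cases "ess_inf_on A g") auto
qed

section \<open>The maximum of an i.i.d. sample and a single observation\<close>

lemma (in prob_space) prob_Max_le:
  fixes X :: "'i \<Rightarrow> 'a \<Rightarrow> real"
  assumes "finite I" "I \<noteq> {}"
    and X: "\<And>i. i \<in> I \<Longrightarrow> random_variable borel (X i)"
    and D: "\<And>i. i \<in> I \<Longrightarrow> distr M borel (X i) = D"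
    and B: "B \<in> sets borel"
  shows "prob {\<omega> \<in> space M. (MAX i\<in>I. X i \<omega>) \<in> B} \<le> real (card I) * measure D B"
proof -
  have "prob {\<omega> \<in> space M. (MAX i\<in>I. X i \<omega>) \<in> B} \<le> prob (\<Union>i\<in>I. X i -` B \<inter> space M)"
  proof (rule finite_measure_mono)
    show "(\<Union>i\<in>I. X i -` B \<inter> space M) \<in> events"
      using \<open>finite I\<close> X B by (auto intro!: sets.finite_UN measurable_sets)
    show "{\<omega> \<in> space M. (MAX i\<in>I. X i \<omega>) \<in> B} \<subseteq> (\<Union>i\<in>I. X i -` B \<inter> space M)"
    proof
      fix \<omega> assume \<omega>: "\<omega> \<in> {\<omega> \<in> space M. (MAX i\<in>I. X i \<omega>) \<in> B}"
      have "(MAX i\<in>I. X i \<omega>) \<in> (\<lambda>i. X i \<omega>) ` I"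
        using assms(1,2) by (intro Max_in) auto
      with \<omega> show "\<omega> \<in> (\<Union>i\<in>I. X i -` B \<inter> space M)" by auto
    qed
  qed
  also have "\<dots> \<le> (\<Sum>i\<in>I. prob (X i -` B \<inter> space M))"
    using \<open>finite I\<close> X B by (intro finite_measure_subadditive_finite) (auto intro!: measurable_sets)
  also have "\<dots> = (\<Sum>i\<in>I. measure D B)"
    using X B D by (intro sum.cong refl) (metis measure_distr)
  finally show ?thesis by simp
qed

text \<open>
  The event that observation \<open>i\<close> lies in \<open>B\<close> while all the others stay below \<open>b\<close> makes observation
  \<open>i\<close> the maximum, because \<open>B\<close> lies to the right of \<open>b\<close>; for the same reason these events are
  disjoint for distinct \<open>i\<close>. By disjointness the factor \<open>card I\<close> survives, so that this bound
  matches the union bound.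
\<close>
lemma (in prob_space) prob_Max_ge:
  fixes X :: "'i \<Rightarrow> 'a \<Rightarrow> real"
  assumes "finite I"
    and indep: "indep_vars (\<lambda>_. borel) X I"
    and D: "\<And>i. i \<in> I \<Longrightarrow> distr M borel (X i) = D"
    and B: "B \<in> sets borel" "B \<subseteq> {b..}"
  shows "real (card I) * (measure D B * measure D {..<b} ^ (card I - 1))
           \<le> prob {\<omega> \<in> space M. (MAX i\<in>I. X i \<omega>) \<in> B}"
proof -
  have X: "random_variable borel (X i)" if "i \<in> I" for i
    using indep that by (auto simp: indep_vars_def)
  have prob_X: "prob (X i -` C \<inter> space M) = measure D C" if "i \<in> I" "C \<in> sets borel" for i C
    using X D that by (metis measure_distr)
  define C where "C i j = (if j = i then B else {..<b})" for i j :: 'i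
  have C: "C i j \<in> sets borel" for i j
    using B(1) by (auto simp: C_def)
  define E where "E i = (\<Inter>j\<in>I. X j -` C i j \<inter> space M)" for i
  have E_iff: "\<omega> \<in> E i \<longleftrightarrow> \<omega> \<in> space M \<and> (\<forall>j\<in>I. X j \<omega> \<in> C i j)" if "i \<in> I" for i \<omega>
    using that by (auto simp: E_def)
  have E_sets: "E i \<in> events" if "i \<in> I" for i
    unfolding E_def using that \<open>finite I\<close> X C
    by (intro sets.finite_INT) (auto intro!: measurable_sets)
  have prob_E: "prob (E i) = measure D B * measure D {..<b} ^ (card I - 1)" if i: "i \<in> I" for i
  proof -
    have "prob (E i) = (\<Prod>j\<in>I. prob (X j -` C i j \<inter> space M))"
      unfolding E_def using \<open>finite I\<close> i C by (intro indep_varsD[OF indep]) auto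
    also have "\<dots> = (\<Prod>j\<in>I. measure D (C i j))"
      using C by (intro prod.cong refl prob_X) auto
    also have "\<dots> = measure D (C i i) * (\<Prod>j\<in>I - {i}. measure D (C i j))"
      using \<open>finite I\<close> i by (rule prod.remove)
    also have "\<dots> = measure D B * (\<Prod>j\<in>I - {i}. measure D {..<b})"
      by (auto simp: C_def intro!: prod.cong)
    finally show ?thesis using i by simp
  qed
  have "real (card I) * (measure D B * measure D {..<b} ^ (card I - 1)) = (\<Sum>i\<in>I. prob (E i))"
    using prob_E by simp
  also have "\<dots> = prob (\<Union>i\<in>I. E i)"
  proof (rule finite_measure_finite_Union[symmetric])
    show "disjoint_family_on E I"
      unfolding disjoint_family_on_def
    proof safe
      fix i j \<omega> assume ij: "i \<in> I" "j \<in> I" "i \<noteq> j" and \<omega>: "\<omega> \<in> E i" "\<omega> \<in> E j"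
      have "X i \<omega> \<in> B" "X i \<omega> < b"
        using \<omega> ij by (auto simp: E_iff C_def split: if_splits)
      then show "\<omega> \<in> {}" using B(2) by auto
    qed
  qed (use \<open>finite I\<close> E_sets in auto)
  also have "\<dots> \<le> prob {\<omega> \<in> space M. (MAX i\<in>I. X i \<omega>) \<in> B}"
  proof (rule finite_measure_mono)
    show "(\<Union>i\<in>I. E i) \<subseteq> {\<omega> \<in> space M. (MAX i\<in>I. X i \<omega>) \<in> B}"
    proof
      fix \<omega> assume "\<omega> \<in> (\<Union>i\<in>I. E i)"
      then obtain i where i: "i \<in> I" and \<omega>: "\<omega> \<in> E i" by auto
      have XB: "X i \<omega> \<in> B" "\<omega> \<in> space M"
        using \<omega> i by (auto simp: E_iff C_def)
      have "X j \<omega> \<le> X i \<omega>" if "j \<in> I" for j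
      proof (cases "j = i")
        case False
        then have "X j \<omega> < b" using \<omega> i that by (auto simp: E_iff C_def)
        then show ?thesis using XB B(2) by auto
      qed simp
      then have "(MAX j\<in>I. X j \<omega>) = X i \<omega>"
        using \<open>finite I\<close> i by (intro Max_eqI) auto
      then show "\<omega> \<in> {\<omega> \<in> space M. (MAX i\<in>I. X i \<omega>) \<in> B}" using XB by simp
    qed
    have "(\<lambda>\<omega>. MAX i\<in>I. X i \<omega>) \<in> borel_measurable M"
      using \<open>finite I\<close> X by (rule borel_measurable_Max)
    then show "{\<omega> \<in> space M. (MAX i\<in>I. X i \<omega>) \<in> B} \<in> events"
      using B(1) by measurable
  qed
  finally show ?thesis .
qed

section \<open>Gaussian probabilities of affine images\<close>

abbreviation std_normal :: "real measure"
  where "std_normal \<equiv> density lborel (\<lambda>x. ennreal (std_normal_density x))"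

lemma prob_space_std_normal: "prob_space std_normal"
  using prob_space_normal_density[of 1 0] by simp

lemma emeasure_std_normal_affine:
  assumes "0 < s" "A \<in> sets borel"
  shows "emeasure std_normal {y. (y - b) / s \<in> A}
           = (\<integral>\<^sup>+x. ennreal (s * std_normal_density (b + s * x)) * indicator A x \<partial>lborel)"
proof -
  define B where "B = {y. (y - b) / s \<in> A}"
  have B: "B \<in> sets borel"
    unfolding B_def using assms(2) by measurable
  have "emeasure std_normal B = (\<integral>\<^sup>+y. ennreal (std_normal_density y) * indicator B y \<partial>lborel)"
    using B by (simp add: emeasure_density)
  also have "\<dots> = ennreal \<bar>s\<bar> * (\<integral>\<^sup>+x. ennreal (std_normal_density (b + s * x)) * indicator B (b + s * x) \<partial>lborel)"
    using B assms(1) by (intro nn_integral_real_affine) auto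
  also have "\<dots> = (\<integral>\<^sup>+x. ennreal \<bar>s\<bar> * (ennreal (std_normal_density (b + s * x)) * indicator B (b + s * x)) \<partial>lborel)"
    using B by (intro nn_integral_cmult[symmetric]) (auto intro!: borel_measurable_times_ennreal measurable_compose[of _ _ borel])
  also have "\<dots> = (\<integral>\<^sup>+x. ennreal (s * std_normal_density (b + s * x)) * indicator A x \<partial>lborel)"
    using assms(1) by (intro nn_integral_cong) (auto simp: B_def indicator_def ennreal_mult)
  finally show ?thesis unfolding B_def .
qed

lemma std_normal_density_add:
  "std_normal_density (b + h) = std_normal_density b * exp (- (b * h + h\<^sup>2 / 2))"
proof -
  have "- (b + h)\<^sup>2 / 2 = - b\<^sup>2 / 2 + - (b * h + h\<^sup>2 / 2)"
    by (simp add: power2_eq_square field_simps)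
  then show ?thesis
    by (simp only: std_normal_density_def exp_add mult.assoc)
qed

text \<open>
  For \<open>b, x \<ge> 0\<close> the cross term in \<open>(b + x)\<^sup>2\<close> can be dropped, so the density at \<open>b + x\<close> is at most
  its value at \<open>b\<close> times \<open>exp (- x\<^sup>2 / 2)\<close>. The bound is weaker than the Mills
  ratio by a factor of order \<open>b\<close>, which costs only a factor of order \<open>a\<^sub>n\<close> in the tail at \<open>b\<^sub>n\<close>.
\<close>
lemma std_normal_tail_le:
  assumes "0 \<le> b"
  shows "measure std_normal {b..} \<le> sqrt (2 * pi) * std_normal_density b"
proof -
  interpret prob_space std_normal by (rule prob_space_std_normal)
  have "{b..} = {y. (y - b) / 1 \<in> {0..}}"
    by auto
  then have "emeasure std_normal {b..}
      = (\<integral>\<^sup>+x. ennreal (1 * std_normal_density (b + 1 * x)) * indicator {0..} x \<partial>lborel)"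
    by (simp only: emeasure_std_normal_affine[of 1 "{0..}" b] zero_less_one atLeast_borel)
  also have "\<dots> \<le> (\<integral>\<^sup>+x. ennreal (sqrt (2 * pi) * std_normal_density b) * ennreal (std_normal_density x) \<partial>lborel)"
  proof (intro nn_integral_mono)
    fix x :: real
    show "ennreal (1 * std_normal_density (b + 1 * x)) * indicator {0..} x
        \<le> ennreal (sqrt (2 * pi) * std_normal_density b) * ennreal (std_normal_density x)"
    proof (cases "0 \<le> x")
      case True
      have "std_normal_density (b + x) \<le> std_normal_density b * exp (- (x\<^sup>2 / 2))"
        unfolding std_normal_density_add using True assms by (intro mult_left_mono) auto
      also have "\<dots> = sqrt (2 * pi) * std_normal_density b * std_normal_density x"
        by (simp add: std_normal_density_def)
      finally show ?thesis
        using True by (auto simp: ennreal_mult[symmetric] intro!: ennreal_leI)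
    qed simp
  qed
  also have "\<dots> = ennreal (sqrt (2 * pi) * std_normal_density b) * emeasure std_normal (space std_normal)"
    by (subst nn_integral_cmult) (auto simp: emeasure_density)
  also have "\<dots> = ennreal (sqrt (2 * pi) * std_normal_density b)"
    by (simp only: emeasure_space_1 mult_1_right)
  finally show ?thesis
    by (auto simp: emeasure_eq_measure)
qed

text \<open>
  Upper half of Laplace's method. With \<open>g x = x + x\<^sup>2 / 4\<close>, the condition \<open>b \<le> 2 * s\<close> gives
  \<open>b * s * x + s\<^sup>2 * x\<^sup>2 / 2 \<ge> b * s * g x\<close>. One unit of the factor \<open>b * s\<close> is split off: since
  \<open>g x \<ge> x\<close>, it leaves the integrable weight \<open>exp (- x)\<close>, so that \<open>A\<close> may be unbounded.
\<close>
lemma std_normal_affine_le: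
  assumes s: "0 < s" "1 \<le> b * s" "b \<le> 2 * s"
    and A: "A \<in> sets borel" "A \<subseteq> {0..}"
    and m: "{x \<in> A. x + x\<^sup>2 / 4 < m} \<in> null_sets lborel"
  shows "measure std_normal {y. (y - b) / s \<in> A} \<le> s * std_normal_density b * exp (- ((b * s - 1) * m))"
proof -
  interpret prob_space std_normal by (rule prob_space_std_normal)
  define K where "K = s * std_normal_density b * exp (- ((b * s - 1) * m))"
  have K: "0 \<le> K" using s by (simp add: K_def)
  have pointwise: "s * std_normal_density (b + s * x) \<le> K * exp (- x)"
    if x: "0 \<le> x" "m \<le> x + x\<^sup>2 / 4" for x
  proof -
    have "b * s * x\<^sup>2 \<le> 2 * s * s * x\<^sup>2"
      using s by (intro mult_right_mono) auto
    then have "b * s * (x + x\<^sup>2 / 4) \<le> b * (s * x) + (s * x)\<^sup>2 / 2"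
      by (simp add: power2_eq_square algebra_simps)
    moreover have "(b * s - 1) * m \<le> (b * s - 1) * (x + x\<^sup>2 / 4)"
      using s x by (intro mult_left_mono) auto
    moreover have "(b * s - 1) * (x + x\<^sup>2 / 4) = b * s * (x + x\<^sup>2 / 4) - x - x\<^sup>2 / 4"
      by (simp add: field_simps)
    moreover have "0 \<le> x\<^sup>2" by simp
    ultimately have "(b * s - 1) * m + x \<le> b * (s * x) + (s * x)\<^sup>2 / 2"
      by linarith
    then have "s * std_normal_density (b + s * x) \<le> s * (std_normal_density b * exp (- ((b * s - 1) * m + x)))"
      unfolding std_normal_density_add using s by (intro mult_left_mono) auto
    also have "\<dots> = K * exp (- x)"
      by (simp add: K_def exp_add[symmetric])
    finally show ?thesis .
  qed
  have "AE x in lborel. x \<notin> {x \<in> A. x + x\<^sup>2 / 4 < m}"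
    using m by (rule AE_not_in)
  then have "emeasure std_normal {y. (y - b) / s \<in> A}
      \<le> (\<integral>\<^sup>+x. ennreal K * (ennreal (x ^ 0 * exp (- x)) * indicator {0..} x) \<partial>lborel)"
    unfolding emeasure_std_normal_affine[OF s(1) A(1)]
  proof (intro nn_integral_mono_AE, eventually_elim)
    case (elim x)
    show ?case
    proof (cases "x \<in> A")
      case True
      then have "0 \<le> x" "m \<le> x + x\<^sup>2 / 4" using elim A(2) by auto
      from pointwise[OF this] show ?thesis
        using True \<open>0 \<le> x\<close> K by (auto simp: ennreal_mult[symmetric] intro!: ennreal_leI)
    qed simp
  qed
  also have "\<dots> = ennreal K"
    by (subst nn_integral_cmult) (simp_all add: nn_intergal_power_times_exp_Ici[of 0, simplified])
  finally show ?thesis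
    unfolding K_def[symmetric] using K by (simp add: emeasure_eq_measure)
qed

text \<open>
  The lower bound uses the real-valued measure of these sets, which is \<open>0\<close> by default at infinite
  measure.
\<close>
lemma emeasure_rate_sublevel_finite:
  fixes A :: "real set"
  assumes "A \<subseteq> {0..}"
  shows "emeasure lborel {x \<in> A. x + x\<^sup>2 / 4 < c} < \<infinity>"
proof -
  have "{x \<in> A. x + x\<^sup>2 / 4 < c} \<subseteq> {0..c}"
  proof
    fix x assume "x \<in> {x \<in> A. x + x\<^sup>2 / 4 < c}"
    then have "0 \<le> x" "x + x\<^sup>2 / 4 < c" "0 \<le> x\<^sup>2" using assms by auto
    then have "x \<le> c" by linarith
    with \<open>0 \<le> x\<close> show "x \<in> {0..c}" by simp
  qed
  then have "emeasure lborel {x \<in> A. x + x\<^sup>2 / 4 < c} \<le> emeasure lborel {0..c}"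
    by (intro emeasure_mono) auto
  also have "\<dots> < \<infinity>"
    by (simp add: emeasure_lborel_Icc_eq)
  finally show ?thesis .
qed

text \<open>
  Lower half of Laplace's method: \<open>b * s * x + s\<^sup>2 * x\<^sup>2 / 2\<close> is at most \<open>2 * s\<^sup>2 * (x + x\<^sup>2 / 4)\<close>, again
  by \<open>b \<le> 2 * s\<close>, so the integrand is bounded below on a sublevel set of the rate function.
\<close>
lemma std_normal_affine_ge:
  assumes s: "0 < s" "b \<le> 2 * s"
    and A: "A \<in> sets borel" "A \<subseteq> {0..}"
  shows "s * std_normal_density b * exp (- (2 * s\<^sup>2 * c)) * measure lborel {x \<in> A. x + x\<^sup>2 / 4 < c}
           \<le> measure std_normal {y. (y - b) / s \<in> A}"
proof -
  interpret prob_space std_normal by (rule prob_space_std_normal)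
  define S where "S = {x \<in> A. x + x\<^sup>2 / 4 < c}"
  define K where "K = s * std_normal_density b * exp (- (2 * s\<^sup>2 * c))"
  have K: "0 \<le> K" using s by (simp add: K_def)
  have S: "S \<in> sets borel"
    unfolding S_def using A(1) by measurable
  have S_fin: "emeasure lborel S = ennreal (measure lborel S)"
    using emeasure_rate_sublevel_finite[OF A(2), of c]
    unfolding S_def by (intro emeasure_eq_ennreal_measure) auto
  have pointwise: "K \<le> s * std_normal_density (b + s * x)" if "x \<in> S" for x
  proof -
    have x: "0 \<le> x" "x + x\<^sup>2 / 4 < c"
      using that A(2) by (auto simp: S_def)
    have "b * (s * x) \<le> 2 * s * (s * x)"
      using s x by (intro mult_right_mono) auto
    then have "b * (s * x) + (s * x)\<^sup>2 / 2 \<le> 2 * s\<^sup>2 * (x + x\<^sup>2 / 4)"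
      by (simp add: power2_eq_square algebra_simps)
    also have "\<dots> \<le> 2 * s\<^sup>2 * c"
      using x by (intro mult_left_mono) auto
    finally show ?thesis
      unfolding K_def std_normal_density_add mult.assoc using s by (intro mult_left_mono) auto
  qed
  have "ennreal (K * measure lborel S) = (\<integral>\<^sup>+x. ennreal K * indicator S x \<partial>lborel)"
    using S K by (simp add: nn_integral_cmult_indicator S_fin ennreal_mult)
  also have "\<dots> \<le> emeasure std_normal {y. (y - b) / s \<in> A}"
    unfolding emeasure_std_normal_affine[OF s(1) A(1)]
  proof (intro nn_integral_mono)
    fix x
    show "ennreal K * indicator S x \<le> ennreal (s * std_normal_density (b + s * x)) * indicator A x"
      using pointwise[of x] by (cases "x \<in> S") (auto simp: S_def intro!: ennreal_leI)
  qed
  finally show ?thesis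
    unfolding K_def S_def by (simp add: emeasure_eq_measure)
qed

section \<open>Asymptotics of the normalising sequences\<close>

lemma a_seq_pos: "n \<ge> 2 \<Longrightarrow> 0 < a_seq n"
  by (simp add: a_seq_def)

lemma a_seq_sq: "n \<ge> 2 \<Longrightarrow> (a_seq n)\<^sup>2 = 2 * ln (real n)"
  by (simp add: a_seq_def)

text \<open>The numerator of the correction term in \<^const>\<open>b_seq\<close>.\<close>
definition log_corr :: "nat \<Rightarrow> real"
  where "log_corr n = ln (sqrt (2 * pi) * a_seq n)"

lemma b_seq_mult_half_a_seq:
  assumes "n \<ge> 2"
  shows "b_seq n * (a_seq n / 2) = ln (real n) - log_corr n / 2"
  using a_seq_pos[OF assms] a_seq_sq[OF assms]
  by (simp add: b_seq_def log_corr_def field_simps power2_eq_square)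

text \<open>
  This is where the choice of \<^const>\<open>b_seq\<close> enters: in the square of \<open>b\<^sub>n\<close> the cross term
  \<open>- 2 * log_corr n\<close> contributes exactly the factor \<open>sqrt (2 * pi) * a_seq n\<close>, which cancels the
  normalisation of the density.
\<close>
lemma std_normal_density_b_seq:
  assumes "n \<ge> 2"
  shows "std_normal_density (b_seq n) = a_seq n / real n * exp (- ((log_corr n)\<^sup>2 / (4 * ln (real n))))"
proof -
  have a: "0 < a_seq n" "(a_seq n)\<^sup>2 = 2 * ln (real n)"
    using a_seq_pos a_seq_sq assms by auto
  have "(b_seq n)\<^sup>2 = (a_seq n)\<^sup>2 - 2 * log_corr n + (log_corr n)\<^sup>2 / (a_seq n)\<^sup>2"
    unfolding b_seq_def log_corr_def[symmetric] power2_diff using a(1) by (simp add: power_divide)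
  then have "- (b_seq n)\<^sup>2 / 2 = - ln (real n) + log_corr n + - ((log_corr n)\<^sup>2 / (4 * ln (real n)))"
    unfolding a(2) by simp
  then have "exp (- (b_seq n)\<^sup>2 / 2)
      = exp (- ln (real n)) * exp (log_corr n) * exp (- ((log_corr n)\<^sup>2 / (4 * ln (real n))))"
    by (simp only: exp_add)
  also have "exp (- ln (real n)) = 1 / real n"
    using assms by (simp add: exp_minus inverse_eq_divide)
  also have "exp (log_corr n) = sqrt (2 * pi) * a_seq n"
    unfolding log_corr_def using a by (intro exp_ln mult_pos_pos) simp_all
  finally show ?thesis
    by (simp add: std_normal_density_def)
qed

text \<open>
  The prefactor of the Gaussian integral equals \<open>log n\<close> times a factor that tends to \<open>1\<close>, because
  \<^const>\<open>log_corr\<close> grows like \<open>log (log n) / 2\<close>.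
\<close>
lemma prefactor_rate:
  "(\<lambda>n. ln (real n * (a_seq n / 2 * std_normal_density (b_seq n))) / ln (real n)) \<longlonglongrightarrow> 0"
proof -
  have "(\<lambda>n. ln (ln (real n) * exp (- ((log_corr n)\<^sup>2 / (4 * ln (real n))))) / ln (real n)) \<longlonglongrightarrow> 0"
    unfolding log_corr_def a_seq_def by real_asymp
  moreover have "\<forall>\<^sub>F n in sequentially. ln (ln (real n) * exp (- ((log_corr n)\<^sup>2 / (4 * ln (real n))))) / ln (real n)
      = ln (real n * (a_seq n / 2 * std_normal_density (b_seq n))) / ln (real n)"
    using eventually_ge_at_top[of 2]
  proof eventually_elim
    case (elim n)
    then have "real n * (a_seq n / 2 * std_normal_density (b_seq n))
        = (a_seq n)\<^sup>2 / 2 * exp (- ((log_corr n)\<^sup>2 / (4 * ln (real n))))"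
      by (simp add: std_normal_density_b_seq power2_eq_square)
    then show ?case
      using elim by (simp add: a_seq_sq)
  qed
  ultimately show ?thesis
    by (rule Lim_transform_eventually)
qed

text \<open>The \<open>- 1\<close> is the unit of the exponent split off in \<open>std_normal_affine_le\<close>.\<close>
lemma b_seq_mult_half_a_seq_rate:
  "(\<lambda>n. (b_seq n * (a_seq n / 2) - 1) / ln (real n)) \<longlonglongrightarrow> 1"
proof -
  have "(\<lambda>n. (ln (real n) - log_corr n / 2 - 1) / ln (real n)) \<longlonglongrightarrow> 1"
    unfolding log_corr_def a_seq_def by real_asymp
  moreover have "\<forall>\<^sub>F n in sequentially. (ln (real n) - log_corr n / 2 - 1) / ln (real n)
      = (b_seq n * (a_seq n / 2) - 1) / ln (real n)"
    using eventually_ge_at_top[of 2] by eventually_elim (simp only: b_seq_mult_half_a_seq)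
  ultimately show ?thesis
    by (rule Lim_transform_eventually)
qed

lemma eventually_b_seq_bounds:
  "\<forall>\<^sub>F n in sequentially. 0 \<le> b_seq n \<and> b_seq n \<le> a_seq n \<and> 1 \<le> b_seq n * (a_seq n / 2)
     \<and> sqrt (2 * pi) * std_normal_density (b_seq n) < 1"
  unfolding std_normal_density_def b_seq_def a_seq_def
  by (intro eventually_conj; real_asymp)

text \<open>
  The tail at \<open>b\<^sub>n\<close> is at most a constant times \<open>a\<^sub>n / n\<close>, so the probability that none of \<open>n\<close>
  observations exceeds \<open>b\<^sub>n\<close> is at least \<open>exp (- C * a\<^sub>n)\<close> for some constant \<open>C\<close> and large \<open>n\<close>, and
  \<open>a\<^sub>n\<close> is of smaller order than \<open>log n\<close>.
\<close>
lemma no_exceedance_rate: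
  "(\<lambda>n. real n * ln (1 - measure std_normal {b_seq n..}) / ln (real n)) \<longlonglongrightarrow> 0"
proof (rule tendsto_sandwich)
  define t where "t n = sqrt (2 * pi) * std_normal_density (b_seq n)" for n
  have "(\<lambda>n. real n * ln (1 - sqrt (2 * pi) * (a_seq n / real n * exp (- ((log_corr n)\<^sup>2 / (4 * ln (real n)))))) / ln (real n)) \<longlonglongrightarrow> 0"
    unfolding log_corr_def a_seq_def by real_asymp
  moreover have "\<forall>\<^sub>F n in sequentially.
      real n * ln (1 - sqrt (2 * pi) * (a_seq n / real n * exp (- ((log_corr n)\<^sup>2 / (4 * ln (real n)))))) / ln (real n)
      = real n * ln (1 - t n) / ln (real n)"
    using eventually_ge_at_top[of 2]
    by eventually_elim (simp add: t_def std_normal_density_b_seq)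
  ultimately show "(\<lambda>n. real n * ln (1 - t n) / ln (real n)) \<longlonglongrightarrow> 0"
    by (rule Lim_transform_eventually)
  have *: "\<forall>\<^sub>F n in sequentially. 0 \<le> measure std_normal {b_seq n..} \<and> measure std_normal {b_seq n..} \<le> t n \<and> t n < 1"
    using eventually_b_seq_bounds unfolding t_def
    by eventually_elim (use std_normal_tail_le in auto)
  from * show "\<forall>\<^sub>F n in sequentially. real n * ln (1 - t n) / ln (real n)
      \<le> real n * ln (1 - measure std_normal {b_seq n..}) / ln (real n)"
    using eventually_ge_at_top[of 2]
    by eventually_elim (auto intro!: divide_right_mono mult_left_mono)
  from * show "\<forall>\<^sub>F n in sequentially. real n * ln (1 - measure std_normal {b_seq n..}) / ln (real n) \<le> 0"
    using eventually_ge_at_top[of 2]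
    by eventually_elim (auto intro!: divide_nonpos_nonneg mult_nonneg_nonpos)
qed simp

section \<open>The limit theorem\<close>

text \<open>
  A sandwich in which the lower bound reaches the limit only up to an arbitrarily small loss.
  It is used with sublevel sets at levels \<open>c > m\<close>, since the strict sublevel set of the rate function at its essential infimum \<open>m\<close>
  is null.
\<close>
lemma tendsto_squeeze_lower_family:
  fixes f u :: "nat \<Rightarrow> real" and l :: "real \<Rightarrow> nat \<Rightarrow> real"
  assumes u: "u \<longlonglongrightarrow> - m" "\<forall>\<^sub>F n in sequentially. f n \<le> u n"
    and l: "\<And>c. m < c \<Longrightarrow> l c \<longlonglongrightarrow> - c" "\<And>c. m < c \<Longrightarrow> \<forall>\<^sub>F n in sequentially. l c n \<le> f n"
  shows "f \<longlonglongrightarrow> - m"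
proof (rule order_tendstoI)
  fix y assume "y < - m"
  then obtain c where c: "m < c" "c < - y"
    using dense[of m "- y"] by auto
  then have "\<forall>\<^sub>F n in sequentially. y < l c n"
    using order_tendstoD(1)[OF l(1)[OF c(1)]] by simp
  then show "\<forall>\<^sub>F n in sequentially. y < f n"
    using l(2)[OF c(1)] by eventually_elim linarith
next
  fix y assume "- m < y"
  from order_tendstoD(2)[OF u(1) this] u(2) show "\<forall>\<^sub>F n in sequentially. f n < y"
    by eventually_elim linarith
qed

theorem theorem1:
  fixes M :: "'a measure" and X :: "nat \<Rightarrow> 'a \<Rightarrow> real" and A :: "real set"
  assumes "prob_space M"
    and "prob_space.indep_vars M (\<lambda>_. borel) X {1..}"
    and "\<And>i. i \<ge> 1 \<Longrightarrow> distributed M lborel (X i) (\<lambda>x. ennreal (std_normal_density x))"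
    and "A \<in> sets borel"
    and "A \<subseteq> {0..}"
  shows "(\<lambda>n. ereal (1 / ln (real n)) * eln (measure M {\<omega> \<in> space M. Z_seq X n \<omega> \<in> A}))
           \<longlonglongrightarrow> - ess_inf_on A (\<lambda>x. x + x\<^sup>2 / 4)"
proof -
  interpret prob_space M by fact
  interpret N: prob_space std_normal by (rule prob_space_std_normal)
  define g where "g x = x + x\<^sup>2 / 4" for x :: real
  define P where "P n = prob {\<omega> \<in> space M. Z_seq X n \<omega> \<in> A}" for n
  define B where "B n = {y. (y - b_seq n) / (a_seq n / 2) \<in> A}" for n
  define w where "w n = real n * (a_seq n / 2 * std_normal_density (b_seq n))" for n
  define q where "q n = measure std_normal {b_seq n..}" for n
  have D: "distr M borel (X i) = std_normal" if "i \<in> {1..n}" for i n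
    using assms(3)[of i] that by (simp add: distributed_def cong: distr_cong)
  have X: "random_variable borel (X i)" if "i \<in> {1..n}" for i n
    using assms(3)[of i] that by (simp add: distributed_def)
  have indep: "indep_vars (\<lambda>_. borel) X {1..n}" for n
    by (rule indep_vars_subset[OF assms(2)]) auto
  have B_sets: "B n \<in> sets borel" for n
    unfolding B_def using assms(4) by measurable
  have P_eq: "P n = prob {\<omega> \<in> space M. (MAX i\<in>{1..n}. X i \<omega>) \<in> B n}" if "n \<ge> 2" for n
    unfolding P_def B_def by (simp only: Z_seq_alt[OF that] sample_max_def mem_Collect_eq)
  have upper: "P n \<le> real n * measure std_normal (B n)" if "n \<ge> 2" for n
    unfolding P_eq[OF that] using prob_Max_le[of "{1..n}" X, OF _ _ X[of _ n] D[of _ n] B_sets[of n]] that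
    by simp
  have lower: "real n * (measure std_normal (B n) * (1 - q n) ^ (n - 1)) \<le> P n" if "n \<ge> 2" for n
  proof -
    have "B n \<subseteq> {b_seq n..}"
      using assms(5) a_seq_pos[OF that] by (auto simp: B_def zero_le_divide_iff)
    then have "real n * (measure std_normal (B n) * measure std_normal {..<b_seq n} ^ (n - 1)) \<le> P n"
      using prob_Max_ge[OF _ indep[of n] D[of _ n] B_sets[of n]] that by (simp add: P_eq)
    moreover have "measure std_normal {..<b_seq n} = 1 - q n"
    proof -
      have "{..<b_seq n} = space std_normal - {b_seq n..}" by auto
      then show ?thesis
        unfolding q_def by (simp only:) (rule N.prob_compl, simp)
    qed
    ultimately show ?thesis by simp
  qed
  have null_iff: "S \<in> null_sets lborel \<longleftrightarrow> S \<in> null_sets lebesgue" if "S \<in> sets borel" for S :: "real set"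
    using that by (simp add: null_sets_completion_iff)
  have sublevel: "{x \<in> A. g x < c} \<in> sets borel" for c
    unfolding g_def using assms(4) by measurable
  show ?thesis
  proof (cases "A \<in> null_sets lebesgue")
    case True
    have "ereal (1 / ln (real n)) * eln (P n) = - \<infinity>" if "n \<ge> 2" for n
    proof -
      have "A \<in> null_sets lborel"
        using True null_iff assms(4) by blast
      then have "AE x in lborel. x \<notin> A" by (rule AE_not_in)
      then have "emeasure std_normal (B n) = 0"
        unfolding B_def emeasure_std_normal_affine[OF half_gt_zero[OF a_seq_pos[OF that]] assms(4)]
        by (subst nn_integral_0_iff_AE) (use assms(4) in auto)
      then have "P n = 0"
        using upper[OF that] by (simp add: measure_def P_def antisym)
      then show ?thesis
        using that by (simp add: eln_def)
    qed
    then have "\<forall>\<^sub>F n in sequentially. ereal (1 / ln (real n)) * eln (P n) = - \<infinity>"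
      by (rule eventually_mono[OF eventually_ge_at_top])
    then show ?thesis
      unfolding P_def[symmetric] ess_inf_on_null[OF True] by (simp add: tendsto_eventually)
  next
    case False
    obtain m where m: "ess_inf_on A g = ereal m"
    proof (rule ess_inf_on_finite[OF False])
      show "0 \<le> g x" if "x \<in> A" for x
        using that assms(5) by (auto simp: g_def)
    qed
    have below_null: "{x \<in> A. g x < m} \<in> null_sets lborel"
      using null_sublevel_ess_inf_on[OF m] null_iff[OF sublevel] by simp
    define v where "v c = measure lborel {x \<in> A. g x < c}" for c
    have v_pos: "0 < v c" if "m < c" for c
    proof -
      have "emeasure lborel {x \<in> A. g x < c} \<noteq> 0"
        using not_null_sublevel_above_ess_inf_on[OF m that] null_iff[OF sublevel] sublevel
        by (simp add: null_sets_def)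
      then show ?thesis
        using emeasure_rate_sublevel_finite[OF assms(5), of c]
        unfolding v_def g_def measure_def by (simp add: enn2real_positive_iff zero_less_iff_neq_zero)
    qed
    have w_pos: "0 < w n" if "n \<ge> 2" for n
      unfolding w_def using a_seq_pos[OF that] that by (intro mult_pos_pos normal_density_pos) auto
    define u where "u n = ln (w n) / ln (real n) - (b_seq n * (a_seq n / 2) - 1) / ln (real n) * m" for n
    define l where "l c n = ln (w n) / ln (real n) - c + ln (v c) / ln (real n)
        + real n * ln (1 - q n) / ln (real n)" for c n
    have P_ge: "\<forall>\<^sub>F n in sequentially. 0 < P n \<and> l c n \<le> ln (P n) / ln (real n)" if "m < c" for c
      using eventually_b_seq_bounds eventually_ge_at_top[of 2]
    proof eventually_elim
      case (elim n)
      have q: "0 \<le> q n" "q n < 1"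
        using elim std_normal_tail_le[of "b_seq n"] by (auto simp: q_def)
      \<comment> \<open>The exponent \<open>n\<close> instead of \<open>n - 1\<close> only weakens the bound and matches
        the form of \<open>no_exceedance_rate\<close>.\<close>
      define r where "r = w n * exp (- (ln (real n) * c)) * v c * (1 - q n) ^ n"
      have "2 * (a_seq n / 2)\<^sup>2 = ln (real n)"
        using elim a_seq_sq[of n] by (simp add: power_divide)
      then have "a_seq n / 2 * std_normal_density (b_seq n) * exp (- (ln (real n) * c)) * v c \<le> measure std_normal (B n)"
        using std_normal_affine_ge[of "a_seq n / 2" "b_seq n" A c] elim a_seq_pos assms(4,5)
        by (simp add: v_def B_def g_def)
      then have "a_seq n / 2 * std_normal_density (b_seq n) * exp (- (ln (real n) * c)) * v c * (1 - q n) ^ n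
          \<le> measure std_normal (B n) * (1 - q n) ^ (n - 1)"
        using q by (intro mult_mono power_decreasing) auto
      then have "r \<le> real n * (measure std_normal (B n) * (1 - q n) ^ (n - 1))"
        unfolding r_def w_def mult.assoc by (intro mult_left_mono) auto
      also have "\<dots> \<le> P n"
        using lower elim by blast
      finally have "r \<le> P n" .
      moreover have "0 < r"
        using w_pos elim v_pos[OF that] q by (simp add: r_def)
      moreover have "ln r / ln (real n) = l c n"
      proof -
        have "ln r = ln (w n) - ln (real n) * c + ln (v c) + real n * ln (1 - q n)"
          unfolding r_def using w_pos[of n] elim v_pos[OF that] q
          by (simp add: ln_mult ln_realpow)
        then show ?thesis
          using elim by (simp add: l_def add_divide_distrib diff_divide_distrib)
      qed
      ultimately show ?case
        using elim by (auto intro!: divide_right_mono simp flip: \<open>ln r / ln (real n) = l c n\<close>)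
    qed
    have P_pos: "\<forall>\<^sub>F n in sequentially. 0 < P n"
      using P_ge[of "m + 1"] by (auto elim: eventually_mono)
    have "(\<lambda>n. ln (P n) / ln (real n)) \<longlonglongrightarrow> - m"
    proof (rule tendsto_squeeze_lower_family)
      have "u \<longlonglongrightarrow> 0 - 1 * m"
        unfolding u_def w_def
        by (intro tendsto_intros prefactor_rate b_seq_mult_half_a_seq_rate)
      then show "u \<longlonglongrightarrow> - m" by simp
      show "\<forall>\<^sub>F n in sequentially. ln (P n) / ln (real n) \<le> u n"
        using P_pos eventually_b_seq_bounds eventually_ge_at_top[of 2]
      proof eventually_elim
        case (elim n)
        define e where "e = (b_seq n * (a_seq n / 2) - 1) * m"
        have "measure std_normal (B n) \<le> a_seq n / 2 * std_normal_density (b_seq n) * exp (- e)"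
          unfolding B_def e_def using elim a_seq_pos below_null assms(4,5)
          by (intro std_normal_affine_le) (auto simp: g_def)
        then have "real n * measure std_normal (B n) \<le> w n * exp (- e)"
          unfolding w_def mult.assoc by (intro mult_left_mono) auto
        with upper[of n] elim have "P n \<le> w n * exp (- e)"
          by linarith
        then have "ln (P n) \<le> ln (w n) - e"
          using elim w_pos[of n] by (simp add: ln_mult flip: ln_le_cancel_iff)
        moreover have "u n = (ln (w n) - e) / ln (real n)"
          by (simp only: u_def e_def times_divide_eq_left) (rule diff_divide_distrib[symmetric])
        ultimately show ?case
          using elim by (simp add: divide_right_mono)
      qed
      fix c assume c: "m < c"
      have "(\<lambda>n. ln (v c) / ln (real n)) \<longlonglongrightarrow> 0"
        by real_asymp
      then have "l c \<longlonglongrightarrow> 0 - c + 0 + 0"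
        unfolding l_def w_def q_def
        by (intro tendsto_intros prefactor_rate no_exceedance_rate)
      then show "l c \<longlonglongrightarrow> - c" by simp
      show "\<forall>\<^sub>F n in sequentially. l c n \<le> ln (P n) / ln (real n)"
        using P_ge[OF c] by (auto elim: eventually_mono)
    qed
    then have "(\<lambda>n. ereal (ln (P n) / ln (real n))) \<longlonglongrightarrow> ereal (- m)"
      by simp
    moreover have "\<forall>\<^sub>F n in sequentially. ereal (ln (P n) / ln (real n)) = ereal (1 / ln (real n)) * eln (P n)"
      using P_pos by eventually_elim (simp add: eln_def)
    ultimately have "(\<lambda>n. ereal (1 / ln (real n)) * eln (P n)) \<longlonglongrightarrow> ereal (- m)"
      by (rule Lim_transform_eventually)
    then show ?thesis
      using m by (simp add: P_def g_def[abs_def])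
  qed
qed

end
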